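(* Let $K$ be a field, $S=K[x_1,\ldots,x_n]$, and let $0\to U\to M\to N\to 0$ be a short exact sequence of finitely generated multigraded (i.e. $\mathbb Z^n$-graded) $S$-modules. Then $$\operatorname{slength}(M)\leq\operatorname{slength}(U)+\operatorname{slength}(N).$$
   Context: Let $M$ be a finitely generated $\mathbb Z^n$-graded $S$-module, $S=K[x_1,\ldots,x_n]$. A Stanley decomposition of $M$ is a finite direct sum of $K$-vector spaces $\mathcal D: M=\bigoplus_{i=1}^r m_iK[Z_i]$, where each $m_i\in M$ is homogeneous, $Z_i\subset\{x_1,\ldots,x_n\}$, and $m_iK[Z_i]$ is a free $K[Z_i]$-module. Its length is $\operatorname{slength}(\mathcal D)=r$, and the Stanley length of $M$ is $\operatorname{slength}(M)=\min\{\operatorname{slength}(\mathcal D):\mathcal D\text{ is a Stanley decomposition of }M\}$. The zero module has the empty Stanley decomposition, so $\operatorname{slength}(0)=0$. The maps in the exact sequence are homogeneous of degree $0$ (multigraded). *)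

theory Defs
  imports "HOL-Library.Poly_Mapping" "HOL-Library.Extended_Nat"
begin

text \<open>
  The polynomial ring $K[x_1,\dots,x_n]$ is the ring of finitely supported maps from exponent
  vectors to coefficients, with convolution product. The variables are indexed by a finite
  type \<open>'v\<close>, so $n$ is the cardinality of \<open>'v\<close>, and the grading group $\mathbb{Z}^n$
  is \<open>'v \<Rightarrow> int\<close>.
\<close>

type_synonym ('v, 'k) mpol = "('v \<Rightarrow>\<^sub>0 nat) \<Rightarrow>\<^sub>0 'k"

definition polys_in :: "'v set \<Rightarrow> ('v, 'k::zero) mpol set"  (* K[Z] *)
  where "polys_in Z = {p. \<forall>a \<in> Poly_Mapping.keys p. Poly_Mapping.keys a \<subseteq> Z}"

text \<open>The whole group is the internal direct sum of the family \<open>W\<close> over \<open>I\<close>.\<close>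

definition direct_sum_decomp :: "'i set \<Rightarrow> ('i \<Rightarrow> 'm::ab_group_add set) \<Rightarrow> bool"
  where "direct_sum_decomp I W \<longleftrightarrow>
    (\<forall>x. \<exists>!c. (\<forall>i\<in>I. c i \<in> W i) \<and> {i. c i \<noteq> 0} \<subseteq> I \<and> finite {i. c i \<noteq> 0} \<and>
      x = (\<Sum>i | c i \<noteq> 0. c i))"

locale fg_multigraded_module = module scale
  for scale :: "('v::finite, 'k::field) mpol \<Rightarrow> 'm::ab_group_add \<Rightarrow> 'm" +
  fixes G :: "('v \<Rightarrow> int) \<Rightarrow> 'm set"
  assumes zero_in: "0 \<in> G d"
    and add_in: "x \<in> G d \<Longrightarrow> y \<in> G d \<Longrightarrow> x + y \<in> G d"
    \<comment> \<open>For \<open>a = 0\<close> this says that the graded pieces are closed under scalars from the field.\<close>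
    and scale_in: "x \<in> G d \<Longrightarrow>
      scale (Poly_Mapping.single a c) x \<in> G (\<lambda>v. d v + int (Poly_Mapping.lookup a v))"
    and graded: "direct_sum_decomp UNIV G"
    and finitely_generated: "\<exists>B. finite B \<and> span B = UNIV"

text \<open>
  Freeness over a subring \<open>A\<close> of the scalars: \<open>N\<close> has a basis over \<open>A\<close>. The library's
  \<open>module.independent\<close> always takes coefficients from the whole scalar ring.
\<close>

definition free_over :: "('r::comm_ring_1 \<Rightarrow> 'm::ab_group_add \<Rightarrow> 'm) \<Rightarrow> 'r set \<Rightarrow> 'm set \<Rightarrow> bool"
  where "free_over scale A N \<longleftrightarrow>
    (\<exists>B \<subseteq> N. \<forall>x\<in>N. \<exists>!c. range c \<subseteq> A \<and> {b. c b \<noteq> 0} \<subseteq> B \<and> finite {b. c b \<noteq> 0} \<and>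
      x = (\<Sum>b | c b \<noteq> 0. scale (c b) b))"

definition cyclic_space ::
    "(('v, 'k::field) mpol \<Rightarrow> 'm::ab_group_add \<Rightarrow> 'm) \<Rightarrow> 'm \<Rightarrow> 'v set \<Rightarrow> 'm set"  (* m K[Z] *)
  where "cyclic_space scale m Z = (\<lambda>p. scale p m) ` polys_in Z"

definition stanley_decomposition ::
    "(('v, 'k::field) mpol \<Rightarrow> 'm::ab_group_add \<Rightarrow> 'm) \<Rightarrow> (('v \<Rightarrow> int) \<Rightarrow> 'm set) \<Rightarrow>
      ('m \<times> 'v set) list \<Rightarrow> bool"
  where "stanley_decomposition scale G D \<longleftrightarrow>
    (\<forall>(m, Z) \<in> set D. (\<exists>d. m \<in> G d) \<and> free_over scale (polys_in Z) (cyclic_space scale m Z)) \<and>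
    direct_sum_decomp {..<length D} (\<lambda>i. cyclic_space scale (fst (D ! i)) (snd (D ! i)))"

text \<open>
  An infimum in \<open>enat\<close>, so that it would be \<open>\<infinity>\<close> for a module without Stanley decompositions.
  Otherwise it is attained, as the lemma below shows.
\<close>

definition slength ::
    "(('v, 'k::field) mpol \<Rightarrow> 'm::ab_group_add \<Rightarrow> 'm) \<Rightarrow> (('v \<Rightarrow> int) \<Rightarrow> 'm set) \<Rightarrow> enat"
  where "slength scale G = (INF D \<in> Collect (stanley_decomposition scale G). enat (length D))"

lemma slength_attained:
  assumes "stanley_decomposition scale G D"
  shows "\<exists>D'. stanley_decomposition scale G D' \<and> slength scale G = enat (length D')"
proof -
  let ?S = "(\<lambda>D. enat (length D)) ` Collect (stanley_decomposition scale G)"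
  have "?S \<noteq> {}"
    using assms by auto
  then have "Inf ?S \<in> ?S"
    by (meson ex_in_conv wellorder_InfI)
  then show ?thesis
    by (auto simp: slength_def)
qed

definition homogeneous_hom ::
    "(('v, 'k::field) mpol \<Rightarrow> 'a::ab_group_add \<Rightarrow> 'a) \<Rightarrow> (('v \<Rightarrow> int) \<Rightarrow> 'a set) \<Rightarrow>
     (('v, 'k) mpol \<Rightarrow> 'b::ab_group_add \<Rightarrow> 'b) \<Rightarrow> (('v \<Rightarrow> int) \<Rightarrow> 'b set) \<Rightarrow> ('a \<Rightarrow> 'b) \<Rightarrow> bool"
  where "homogeneous_hom s1 G1 s2 G2 f \<longleftrightarrow> module_hom s1 s2 f \<and> (\<forall>d. f ` G1 d \<subseteq> G2 d)"

end

theory Submission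
  imports Defs
begin

text \<open>
  Stanley decompositions of \<open>U\<close> and \<open>N\<close> are concatenated to one of \<open>M\<close>: the generators from \<open>U\<close>
  are mapped to \<open>M\<close> by \<open>f\<close>, and the generators from \<open>N\<close> are lifted along \<open>g\<close> to homogeneous
  elements of \<open>M\<close>. On the space generated by the lift of a nonzero generator, \<open>g\<close> is injective
  because its image is free, so that the space is free as well, and \<open>M\<close> is the direct sum of \<open>f(U)\<close> and
  the span of the lifted spaces, which \<open>g\<close> maps isomorphically onto \<open>N\<close>.
\<close>

text \<open>
  The uniqueness premise comes last because \<open>OF\<close> and chained facts are resolved from the right, so
  that \<open>P\<close> is determined before the higher-order patterns \<open>P b\<close> and \<open>P a\<close> are unified.
\<close>

lemma ex1_unique: "P a \<Longrightarrow> P b \<Longrightarrow> \<exists>!x. P x \<Longrightarrow> a = b"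
  by auto

section \<open>Finite internal direct sums and their extensions\<close>

text \<open>For finite \<open>I\<close> every family supported in \<open>I\<close> has finite
  support, and since the \<open>W i\<close> are closed under differences, uniqueness reduces to the
  representations of 0. On the right-hand side \<open>c\<close> is constrained on \<open>I\<close>
  only, which makes this form easier to use than the definition.\<close>

lemma direct_sum_decomp_finite_iff:
  fixes W :: "'i \<Rightarrow> 'm::ab_group_add set"
  assumes fin: "finite I"
    and zero: "\<And>i. i \<in> I \<Longrightarrow> 0 \<in> W i"
    and diff: "\<And>i x y. i \<in> I \<Longrightarrow> x \<in> W i \<Longrightarrow> y \<in> W i \<Longrightarrow> x - y \<in> W i"
  shows "direct_sum_decomp I W \<longleftrightarrow>
    (\<forall>x. \<exists>c. (\<forall>i\<in>I. c i \<in> W i) \<and> x = sum c I) \<and>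
    (\<forall>c. (\<forall>i\<in>I. c i \<in> W i) \<and> sum c I = 0 \<longrightarrow> (\<forall>i\<in>I. c i = 0))"
proof -
  have supp: "(\<Sum>i | c i \<noteq> 0. c i) = sum c I" if "{i. c i \<noteq> 0} \<subseteq> I" for c :: "'i \<Rightarrow> 'm"
    using that fin by (intro sum.mono_neutral_left) auto
  have decomp_iff: "direct_sum_decomp I W \<longleftrightarrow>
    (\<forall>x. \<exists>!c. (\<forall>i\<in>I. c i \<in> W i) \<and> {i. c i \<noteq> 0} \<subseteq> I \<and> x = sum c I)"
    unfolding direct_sum_decomp_def
    by (intro arg_cong[where f = All] arg_cong[where f = Ex1] ext)
      (use supp fin finite_subset in metis)
  \<comment> \<open>Truncation to \<open>I\<close> turns a family constrained on \<open>I\<close>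
    only into one with support in \<open>I\<close>, without changing its sum over
    \<open>I\<close>.\<close>
  define r :: "('i \<Rightarrow> 'm) \<Rightarrow> 'i \<Rightarrow> 'm" where "r c i = (if i \<in> I then c i else 0)" for c i
  have r: "sum (r c) I = sum c I" "{i. r c i \<noteq> 0} \<subseteq> I" "i \<in> I \<Longrightarrow> r c i = c i" for c i
    by (auto simp: r_def)
  show ?thesis
  proof (intro iffI conjI allI impI)
    fix x
    assume "direct_sum_decomp I W"
    then show "\<exists>c. (\<forall>i\<in>I. c i \<in> W i) \<and> x = sum c I"
      unfolding decomp_iff by blast
  next
    fix c
    assume "direct_sum_decomp I W" and c: "(\<forall>i\<in>I. c i \<in> W i) \<and> sum c I = 0"
    then have ex1: "\<exists>!c. (\<forall>i\<in>I. c i \<in> W i) \<and> {i. c i \<noteq> 0} \<subseteq> I \<and> 0 = sum c I"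
      unfolding decomp_iff by blast
    \<comment> \<open>The truncated family and the zero family both represent 0, so they
      coincide.\<close>
    have "(\<forall>i\<in>I. r c i \<in> W i) \<and> {i. r c i \<noteq> 0} \<subseteq> I \<and> 0 = sum (r c) I"
      using c r by auto
    moreover have "(\<forall>i\<in>I. (0::'m) \<in> W i) \<and> {i::'i. (0::'m) \<noteq> 0} \<subseteq> I \<and> 0 = (\<Sum>i\<in>I. 0::'m)"
      using zero by simp
    moreover note ex1
    ultimately have "r c = (\<lambda>_. 0)"
      by (rule ex1_unique)
    then show "\<forall>i\<in>I. c i = 0"
      using r(3) by metis
  next
    assume *: "(\<forall>x. \<exists>c. (\<forall>i\<in>I. c i \<in> W i) \<and> x = sum c I) \<and>
      (\<forall>c. (\<forall>i\<in>I. c i \<in> W i) \<and> sum c I = 0 \<longrightarrow> (\<forall>i\<in>I. c i = 0))"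
    show "direct_sum_decomp I W"
      unfolding decomp_iff
    proof
      fix x
      obtain c where c: "\<forall>i\<in>I. c i \<in> W i" "x = sum c I"
        using * by blast
      show "\<exists>!c. (\<forall>i\<in>I. c i \<in> W i) \<and> {i. c i \<noteq> 0} \<subseteq> I \<and> x = sum c I"
      proof (rule ex_ex1I)
        show "\<exists>c. (\<forall>i\<in>I. c i \<in> W i) \<and> {i. c i \<noteq> 0} \<subseteq> I \<and> x = sum c I"
          using c r by (intro exI[of _ "r c"]) auto
      next
        fix c d
        assume c: "(\<forall>i\<in>I. c i \<in> W i) \<and> {i. c i \<noteq> 0} \<subseteq> I \<and> x = sum c I"
          and d: "(\<forall>i\<in>I. d i \<in> W i) \<and> {i. d i \<noteq> 0} \<subseteq> I \<and> x = sum d I"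
        \<comment> \<open>The difference of two representations of \<open>x\<close> represents 0,
          hence vanishes on \<open>I\<close>; outside \<open>I\<close> both families are 0.\<close>
        then have "(\<forall>i\<in>I. c i - d i \<in> W i) \<and> (\<Sum>i\<in>I. c i - d i) = 0"
          using diff by (auto simp: sum_subtractf)
        then have "\<forall>i\<in>I. c i - d i = 0"
          using *[THEN conjunct2, THEN spec, of "\<lambda>i. c i - d i"] by blast
        then show "c = d"
          using c d by (intro ext) (metis (mono_tags, lifting) mem_Collect_eq right_minus_eq subsetD)
      qed
    qed
  qed
qed

text \<open>Existence: the components of \<open>g x\<close> are lifted, and what remains of
  \<open>x\<close> lies in the kernel of \<open>g\<close>, that is, in the range of
  \<open>f\<close>. Uniqueness: \<open>g\<close> annihilates the first \<open>a\<close> terms of a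
  relation, so the last \<open>b\<close> terms vanish by uniqueness in the quotient; the rest is a
  relation in the image of \<open>f\<close>, which is pulled back along the injection
  \<open>f\<close>.\<close>

lemma direct_sum_decomp_extension:
  fixes f :: "'u::ab_group_add \<Rightarrow> 'm::ab_group_add" and g :: "'m \<Rightarrow> 'n::ab_group_add"
    and a b :: nat
  assumes f_add: "additive f" and g_add: "additive g"
    and inj: "inj f" and exact: "range f = {x. g x = 0}"
    and U: "direct_sum_decomp {..<a} WU" and N: "direct_sum_decomp {..<b} WN"
    and WU_zero: "\<And>i. i < a \<Longrightarrow> 0 \<in> WU i"
    and WU_diff: "\<And>i x y. i < a \<Longrightarrow> x \<in> WU i \<Longrightarrow> y \<in> WU i \<Longrightarrow> x - y \<in> WU i"
    and WN_zero: "\<And>j. j < b \<Longrightarrow> 0 \<in> WN j"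
    and WN_diff: "\<And>j x y. j < b \<Longrightarrow> x \<in> WN j \<Longrightarrow> y \<in> WN j \<Longrightarrow> x - y \<in> WN j"
    and W_zero: "\<And>i. i < a + b \<Longrightarrow> 0 \<in> W i"
    and W_diff: "\<And>i x y. i < a + b \<Longrightarrow> x \<in> W i \<Longrightarrow> y \<in> W i \<Longrightarrow> x - y \<in> W i"
    and W_U: "\<And>i. i < a \<Longrightarrow> W i = f ` WU i"
    and W_N: "\<And>j. j < b \<Longrightarrow> bij_betw g (W (a + j)) (WN j)"
  shows "direct_sum_decomp {..<a + b} W"
proof -
  interpret f: additive f by fact
  interpret g: additive g by fact
  have gf: "g (f u) = 0" for u
    using exact by blast
  have split: "sum c {..<a + b} = sum c {..<a} + (\<Sum>j<b. c (a + j))" for c :: "nat \<Rightarrow> 'm"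
  proof -
    have "sum c {..<a + b} = sum c {..<a} + sum c {a..<a + b}"
      by (simp add: lessThan_atLeast0 sum.atLeastLessThan_concat)
    also have "sum c {a..<a + b} = (\<Sum>j<b. c (a + j))"
      using sum.shift_bounds_nat_ivl[of c 0 a b]
      by (simp add: lessThan_atLeast0 add.commute)
    finally show ?thesis .
  qed
  have U_iff: "(\<forall>x. \<exists>c. (\<forall>i\<in>{..<a}. c i \<in> WU i) \<and> x = sum c {..<a}) \<and>
      (\<forall>c. (\<forall>i\<in>{..<a}. c i \<in> WU i) \<and> sum c {..<a} = 0 \<longrightarrow> (\<forall>i\<in>{..<a}. c i = 0))"
    using U by (rule direct_sum_decomp_finite_iff[THEN iffD1, rotated -1])
      (use WU_zero WU_diff in auto)
  have U_un: "c i = 0" if "\<And>i. i < a \<Longrightarrow> c i \<in> WU i" "sum c {..<a} = 0" "i < a" for c i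
    using U_iff[THEN conjunct2, THEN spec, of c] that by auto

  have N_iff: "(\<forall>x. \<exists>c. (\<forall>i\<in>{..<b}. c i \<in> WN i) \<and> x = sum c {..<b}) \<and>
      (\<forall>c. (\<forall>i\<in>{..<b}. c i \<in> WN i) \<and> sum c {..<b} = 0 \<longrightarrow> (\<forall>i\<in>{..<b}. c i = 0))"
    using N by (rule direct_sum_decomp_finite_iff[THEN iffD1, rotated -1])
      (use WN_zero WN_diff in auto)
  have N_un: "c i = 0" if "\<And>i. i < b \<Longrightarrow> c i \<in> WN i" "sum c {..<b} = 0" "i < b" for c i
    using N_iff[THEN conjunct2, THEN spec, of c] that by auto

  have ex: "\<exists>c. (\<forall>i\<in>{..<a + b}. c i \<in> W i) \<and> x = sum c {..<a + b}" for x
  proof -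
    obtain cN where cN: "\<And>j. j < b \<Longrightarrow> cN j \<in> WN j" "g x = sum cN {..<b}"
      using N_iff[THEN conjunct1, THEN spec, of "g x"] by auto
    have "\<forall>j<b. \<exists>w. w \<in> W (a + j) \<and> g w = cN j"
      using W_N cN(1) by (metis bij_betw_imp_surj_on imageE)
    then obtain w where w: "\<And>j. j < b \<Longrightarrow> w j \<in> W (a + j)" "\<And>j. j < b \<Longrightarrow> g (w j) = cN j"
      by metis
    \<comment> \<open>The lifts account for all of \<open>g x\<close>, so exactness provides a
      preimage of the remainder under \<open>f\<close>.\<close>
    have "g (x - sum w {..<b}) = 0"
      using w(2) cN(2) by (simp add: g.diff g.sum)
    then obtain u where u: "x - sum w {..<b} = f u"
      using exact by blast
    obtain cU where cU: "\<And>i. i < a \<Longrightarrow> cU i \<in> WU i" "u = sum cU {..<a}"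
      using U_iff[THEN conjunct1, THEN spec, of u] by auto
    define c where "c i = (if i < a then f (cU i) else w (i - a))" for i
    have "c i \<in> W i" if "i < a + b" for i
    proof (cases "i < a")
      case True
      then show ?thesis
        using cU(1) W_U by (simp add: c_def)
    next
      case False
      then show ?thesis
        using w(1)[of "i - a"] that by (simp add: c_def)
    qed
    moreover have "sum c {..<a + b} = f u + sum w {..<b}"
      by (simp add: split c_def cU(2) f.sum)
    then have "x = sum c {..<a + b}"
      using u by (simp add: diff_eq_eq)
    ultimately show ?thesis
      by auto
  qed
  have un: "c i = 0"
    if c: "\<forall>i\<in>{..<a + b}. c i \<in> W i" "sum c {..<a + b} = 0" and i: "i < a + b" for c i
  proof -
    have "\<forall>i<a. \<exists>u. u \<in> WU i \<and> c i = f u"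
      using c(1) W_U by fastforce
    then obtain u where u: "\<And>i. i < a \<Longrightarrow> u i \<in> WU i" "\<And>i. i < a \<Longrightarrow> c i = f (u i)"
      by metis
    \<comment> \<open>Only the last \<open>b\<close> terms survive, because \<open>g\<close>
      composed with \<open>f\<close> is 0.\<close>
    have "g (sum c {..<a + b}) = (\<Sum>j<b. g (c (a + j)))"
      using u(2) by (simp add: split g.add g.sum gf)
    then have "(\<Sum>j<b. g (c (a + j))) = 0"
      using c(2) g.zero by simp
    moreover have "g (c (a + j)) \<in> WN j" if "j < b" for j
      using W_N[OF that] c(1) that by (auto simp: bij_betw_def)
    ultimately have gc: "g (c (a + j)) = 0" if "j < b" for j
      using N_un[of "\<lambda>j. g (c (a + j))"] that by blast
    have N0: "c (a + j) = 0" if "j < b" for j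
    proof (rule inj_onD[of g "W (a + j)"])
      show "inj_on g (W (a + j))"
        using W_N[OF that] by (simp add: bij_betw_def)
    qed (use that c(1) W_zero gc g.zero in auto)
    \<comment> \<open>With the last \<open>b\<close> terms gone, the relation lies entirely in the
      image of \<open>f\<close>.\<close>
    have "f (sum u {..<a}) = f 0"
      using c(2) u(2) N0 by (simp add: split f.sum f.zero)
    then have "sum u {..<a} = 0"
      using inj by (simp add: inj_eq)
    then have U0: "c i = 0" if "i < a" for i
      using U_un[of u] u that f.zero by metis
    show ?thesis
      using U0 N0[of "i - a"] i by (cases "i < a") auto
  qed
  show ?thesis
    using ex un W_zero W_diff by (subst direct_sum_decomp_finite_iff) auto
qed

section \<open>Freeness of cyclic spaces\<close>

lemma zero_in_polys_in: "0 \<in> polys_in Z"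
  and one_in_polys_in: "1 \<in> polys_in Z"
  by (auto simp: polys_in_def)

lemma diff_in_polys_in:
  fixes p q :: "('v, 'k::ab_group_add) mpol"
  shows "p \<in> polys_in Z \<Longrightarrow> q \<in> polys_in Z \<Longrightarrow> p - q \<in> polys_in Z"
  unfolding polys_in_def using keys_diff[of p q] by blast

context module
begin

text \<open>The basis is \<open>{m}\<close>: a coefficient function supported there is determined by
  its value at \<open>m\<close>, which injectivity forces to be the given \<open>p\<close>.\<close>

lemma free_over_singleton:
  assumes inj: "inj_on (\<lambda>p. scale p m) A" and zero: "0 \<in> A" and one: "1 \<in> A"
  shows "free_over scale A ((\<lambda>p. scale p m) ` A)"
  unfolding free_over_def
proof (intro exI[of _ "{m}"] conjI ballI)
  show "{m} \<subseteq> (\<lambda>p. scale p m) ` A"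
    using one by (auto intro!: image_eqI[of _ _ 1])
  fix x
  assume "x \<in> (\<lambda>p. scale p m) ` A"
  then obtain p where p: "p \<in> A" "x = scale p m"
    by blast
  have supp: "finite {b. c b \<noteq> 0}" "(\<Sum>b | c b \<noteq> 0. scale (c b) b) = scale (c m) m"
    if "{b. c b \<noteq> 0} \<subseteq> {m}" for c
  proof -
    show "finite {b. c b \<noteq> 0}"
      using that finite_subset by blast
    have "(\<Sum>b | c b \<noteq> 0. scale (c b) b) = (\<Sum>b\<in>{m}. scale (c b) b)"
      using that by (intro sum.mono_neutral_left) auto
    then show "(\<Sum>b | c b \<noteq> 0. scale (c b) b) = scale (c m) m"
      by simp
  qed
  show "\<exists>!c. range c \<subseteq> A \<and> {b. c b \<noteq> 0} \<subseteq> {m} \<and> finite {b. c b \<noteq> 0} \<and>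
      x = (\<Sum>b | c b \<noteq> 0. scale (c b) b)"
  proof (rule ex1I[of _ "\<lambda>b. if b = m then p else 0"], goal_cases)
    case 1
    have "{b. (if b = m then p else 0) \<noteq> 0} \<subseteq> {m}"
      by auto
    from supp[OF this] this show ?case
      using p zero by auto
  next
    case (2 c)
    then have "scale (c m) m = scale p m" "c m \<in> A"
      using supp[of c] p by auto
    then have "c m = p"
      using inj p(1) by (auto dest: inj_onD)
    with 2 show ?case
      by (intro ext) auto
  qed
qed

text \<open>By commutativity an annihilator \<open>r\<close> of the generator annihilates every
  basis element, which contradicts the uniqueness of coefficients unless \<open>r = 0\<close>. The
  hypothesis on \<open>m\<close> ensures that the basis has an element.\<close>

lemma cyclic_free_overD:
  assumes free: "free_over scale A ((\<lambda>p. scale p m) ` A)" and "m \<noteq> 0"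
    and zero: "0 \<in> A" and one: "1 \<in> A" and r: "r \<in> A" "scale r m = 0"
  shows "r = 0"
proof -
  let ?N = "(\<lambda>p. scale p m) ` A"
  obtain B where "B \<subseteq> ?N"
    and B: "\<And>x. x \<in> ?N \<Longrightarrow> \<exists>!c. range c \<subseteq> A \<and> {b. c b \<noteq> 0} \<subseteq> B \<and> finite {b. c b \<noteq> 0} \<and>
      x = (\<Sum>b | c b \<noteq> 0. scale (c b) b)"
    using free unfolding free_over_def by (elim exE conjE) (rule that, assumption, erule bspec)
  have "m \<in> ?N"
    using one by (auto intro!: image_eqI[of _ _ 1])
  from ex1_implies_ex[OF B[OF this]]
  obtain c where "{b. c b \<noteq> 0} \<subseteq> B" "m = (\<Sum>b | c b \<noteq> 0. scale (c b) b)"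
    by blast
  \<comment> \<open>Over an empty basis \<open>m\<close> would be the empty sum, which is 0.\<close>
  with \<open>m \<noteq> 0\<close> obtain b where "b \<in> B"
    by (metis (mono_tags, lifting) ex_in_conv subset_empty sum.empty)
  then obtain q where "b = scale q m"
    using \<open>B \<subseteq> ?N\<close> by blast
  then have "scale r b = scale q (scale r m)"
    by (simp add: mult.commute)
  then have rb: "scale r b = 0"
    using r by simp
  \<comment> \<open>The coefficient \<open>r\<close> at \<open>b\<close> alone gives a
    representation of 0, to be compared with the zero coefficients.\<close>
  define e where "e b' = (if b' = b then r else 0)" for b'
  have e: "{b. e b \<noteq> 0} \<subseteq> {b}"
    by (auto simp: e_def)
  have "0 \<in> ?N"
    using zero by (auto intro!: image_eqI[of _ _ 0])
  note ex1 = B[OF this]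
  have "(\<Sum>b | e b \<noteq> 0. scale (e b) b) = 0"
    using rb by (intro sum.neutral) (auto simp: e_def)
  then have "range e \<subseteq> A \<and> {b. e b \<noteq> 0} \<subseteq> B \<and> finite {b. e b \<noteq> 0} \<and>
      0 = (\<Sum>b | e b \<noteq> 0. scale (e b) b)"
    using e r(1) zero \<open>b \<in> B\<close> finite_subset[OF e] by (auto simp: e_def)
  moreover have "range (\<lambda>_. 0) \<subseteq> A \<and> {b. (0::'a) \<noteq> 0} \<subseteq> B \<and> finite {b::'b. (0::'a) \<noteq> 0} \<and>
      0 = (\<Sum>b | (0::'a) \<noteq> 0. scale 0 b)"
    using zero by auto
  moreover note ex1
  ultimately have "e = (\<lambda>_. 0)"
    by (rule ex1_unique)
  then show ?thesis
    unfolding e_def by metis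
qed

text \<open>For a nonzero generator, freeness means that its annihilator in \<open>A\<close> is
  trivial. The case \<open>m = 0\<close> is separate, because the zero space is free on the empty
  basis even when multiplication on 0 is not injective.\<close>

lemma free_over_cyclic_iff:
  assumes zero: "0 \<in> A" and one: "1 \<in> A" and diff: "\<And>p q. p \<in> A \<Longrightarrow> q \<in> A \<Longrightarrow> p - q \<in> A"
  shows "free_over scale A ((\<lambda>p. scale p m) ` A) \<longleftrightarrow> m = 0 \<or> inj_on (\<lambda>p. scale p m) A"
proof
  assume free: "free_over scale A ((\<lambda>p. scale p m) ` A)"
  have "inj_on (\<lambda>p. scale p m) A" if "m \<noteq> 0"
  proof (rule inj_onI)
    fix p q
    assume "p \<in> A" "q \<in> A" "scale p m = scale q m"
    then have "p - q \<in> A" "scale (p - q) m = 0"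
      using diff by (auto simp: scale_left_diff_distrib)
    then show "p = q"
      using cyclic_free_overD[OF free \<open>m \<noteq> 0\<close> zero one] by force
  qed
  then show "m = 0 \<or> inj_on (\<lambda>p. scale p m) A"
    by blast
next
  assume "m = 0 \<or> inj_on (\<lambda>p. scale p m) A"
  then show "free_over scale A ((\<lambda>p. scale p m) ` A)"
  proof
    assume "m = 0"
    then have N: "(\<lambda>p. scale p m) ` A = {0}"
      using zero by auto
    have "\<exists>!c. range c \<subseteq> A \<and> {b::'b. c b \<noteq> 0} \<subseteq> {} \<and> finite {b. c b \<noteq> 0} \<and>
      0 = (\<Sum>b | c b \<noteq> 0. scale (c b) b)"
      using zero by (intro ex1I[of _ "\<lambda>_. 0"]) auto
    then show ?thesis
      unfolding free_over_def N by (intro exI[of _ "{}"]) simp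
  qed (use free_over_singleton zero one in blast)
qed

end

lemma
  fixes scale :: "('v, 'k::field) mpol \<Rightarrow> 'm::ab_group_add \<Rightarrow> 'm"
  assumes "module scale"
  shows zero_in_cyclic_space: "0 \<in> cyclic_space scale m Z"
    and diff_in_cyclic_space: "x \<in> cyclic_space scale m Z \<Longrightarrow> y \<in> cyclic_space scale m Z \<Longrightarrow>
      x - y \<in> cyclic_space scale m Z"
    and free_cyclic_space_iff: "free_over scale (polys_in Z) (cyclic_space scale m Z) \<longleftrightarrow>
      m = 0 \<or> inj_on (\<lambda>p. scale p m) (polys_in Z)"
proof -
  interpret module scale by fact
  show "0 \<in> cyclic_space scale m Z"
    using zero_in_polys_in by (auto simp: cyclic_space_def intro!: image_eqI[of _ _ 0])
  show "x - y \<in> cyclic_space scale m Z"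
    if "x \<in> cyclic_space scale m Z" "y \<in> cyclic_space scale m Z"
  proof -
    from that obtain p q where "p \<in> polys_in Z" "x = scale p m" "q \<in> polys_in Z" "y = scale q m"
      by (auto simp: cyclic_space_def)
    then show ?thesis
      unfolding cyclic_space_def
      by (auto intro!: image_eqI[of _ _ "p - q"] diff_in_polys_in simp: scale_left_diff_distrib)
  qed
  show "free_over scale (polys_in Z) (cyclic_space scale m Z) \<longleftrightarrow>
      m = 0 \<or> inj_on (\<lambda>p. scale p m) (polys_in Z)"
    unfolding cyclic_space_def
    by (intro free_over_cyclic_iff zero_in_polys_in one_in_polys_in diff_in_polys_in)
qed

section \<open>Homogeneous homomorphisms and homogeneous lifts\<close>

lemma homogeneous_hom_cyclic_space:
  assumes "homogeneous_hom s1 G1 s2 G2 h"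
  shows "cyclic_space s2 (h m) Z = h ` cyclic_space s1 m Z"
proof -
  interpret module_hom s1 s2 h
    using assms by (simp add: homogeneous_hom_def)
  show ?thesis
    by (auto simp: cyclic_space_def image_image scale)
qed

lemma homogeneous_hom_additive: "homogeneous_hom s1 G1 s2 G2 h \<Longrightarrow> additive h"
  by (simp add: homogeneous_hom_def module_hom_iff additive_def)

text \<open>The degree-\<open>d\<close> component of an arbitrary preimage is a homogeneous preimage.\<close>

lemma homogeneous_lift:
  assumes M: "fg_multigraded_module sM GM" and N: "fg_multigraded_module sN GN"
    and g: "homogeneous_hom sM GM sN GN g" and "surj g" and y: "y \<in> GN d"
  obtains x where "x \<in> GM d" "g x = y"
proof -
  interpret M: fg_multigraded_module sM GM by fact
  interpret N: fg_multigraded_module sN GN by fact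
  interpret g: additive g
    using g by (rule homogeneous_hom_additive)
  obtain z where z: "g z = y"
    using \<open>surj g\<close> by (metis surjD)
  obtain c where c: "\<And>e. c e \<in> GM e" "finite {e. c e \<noteq> 0}" "z = (\<Sum>e | c e \<noteq> 0. c e)"
    using M.graded[unfolded direct_sum_decomp_def, rule_format, THEN ex1_implies_ex, of z] by auto
  \<comment> \<open>Components of \<open>z\<close> may be killed by \<open>g\<close>, so the support
    can shrink.\<close>
  have supp: "{e. g (c e) \<noteq> 0} \<subseteq> {e. c e \<noteq> 0}"
    using g.zero by auto
  have "y = (\<Sum>e | c e \<noteq> 0. g (c e))"
    using z c(3) by (simp add: g.sum)
  also have "\<dots> = (\<Sum>e | g (c e) \<noteq> 0. g (c e))"
    using supp c(2) by (intro sum.mono_neutral_right) auto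
  finally have gc: "(\<forall>e\<in>UNIV. g (c e) \<in> GN e) \<and> {e. g (c e) \<noteq> 0} \<subseteq> UNIV \<and>
      finite {e. g (c e) \<noteq> 0} \<and> y = (\<Sum>e | g (c e) \<noteq> 0. g (c e))"
    using c(1) g finite_subset[OF supp c(2)] by (auto simp: homogeneous_hom_def)
  \<comment> \<open>Since \<open>y\<close> is homogeneous, it also has the decomposition
    concentrated in degree \<open>d\<close>. Uniqueness identifies it with the image of the
    decomposition of \<open>z\<close>; comparing in degree \<open>d\<close> gives the claim.\<close>
  define e where "e d' = (if d' = d then y else 0)" for d'
  have e_supp: "{d'. e d' \<noteq> 0} \<subseteq> {d}"
    by (auto simp: e_def)
  have "(\<Sum>d' | e d' \<noteq> 0. e d') = (\<Sum>d'\<in>{d}. e d')"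
    using e_supp by (intro sum.mono_neutral_left) auto
  then have e: "(\<forall>d'\<in>UNIV. e d' \<in> GN d') \<and> {d'. e d' \<noteq> 0} \<subseteq> UNIV \<and>
      finite {d'. e d' \<noteq> 0} \<and> y = (\<Sum>d' | e d' \<noteq> 0. e d')"
    using y N.zero_in finite_subset[OF e_supp] by (auto simp: e_def)
  have "(\<lambda>e. g (c e)) = e"
    by (rule ex1_unique[OF gc e N.graded[unfolded direct_sum_decomp_def, rule_format]])
  then have "g (c d) = y"
    unfolding e_def by metis
  then show ?thesis
    using that c(1) by blast
qed

section \<open>Combining Stanley decompositions along an exact sequence\<close>

lemma stanley_decomposition_extension:
  assumes U: "fg_multigraded_module sU GU"
    and M: "fg_multigraded_module sM GM"
    and N: "fg_multigraded_module sN GN"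
    and f: "homogeneous_hom sU GU sM GM f"
    and g: "homogeneous_hom sM GM sN GN g"
    and inj: "inj f" and exact: "range f = {x. g x = 0}" and surj: "surj g"
    and DU: "stanley_decomposition sU GU DU" and DN: "stanley_decomposition sN GN DN"
  obtains D where "stanley_decomposition sM GM D" "length D = length DU + length DN"
proof -
  interpret U: fg_multigraded_module sU GU by fact
  interpret M: fg_multigraded_module sM GM by fact
  interpret N: fg_multigraded_module sN GN by fact
  interpret f: module_hom sU sM f
    using f by (simp add: homogeneous_hom_def)
  interpret g: module_hom sM sN g
    using g by (simp add: homogeneous_hom_def)
  \<comment> \<open>The summand \<open>0 K[Z]\<close> is free on the empty basis, so it may occur in \<open>DN\<close> and must lift to \<open>0\<close>.\<close>
  define lift where
    "lift y = (if y = 0 then 0 else SOME x. g x = y \<and> (\<exists>d. x \<in> GM d))" for y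
  have lift_spec: "g (lift y) = y \<and> (\<exists>d. lift y \<in> GM d)" if "\<exists>d. y \<in> GN d" for y
  proof (cases "y = 0")
    case True
    then show ?thesis
      using M.zero_in by (auto simp: lift_def)
  next
    case False
    have "\<exists>x. g x = y \<and> (\<exists>d. x \<in> GM d)"
      using that homogeneous_lift[OF M N g surj] by metis
    from someI_ex[OF this] show ?thesis
      using False by (simp add: lift_def)
  qed
  have lift_inj: "inj_on g (cyclic_space sM (lift y) Z) \<and>
      free_over sM (polys_in Z) (cyclic_space sM (lift y) Z)"
    if "\<exists>d. y \<in> GN d" and free: "free_over sN (polys_in Z) (cyclic_space sN y Z)" for y Z
  proof (cases "y = 0")
    case True
    then have "lift y = 0"
      by (simp add: lift_def)
    then show ?thesis
      unfolding free_cyclic_space_iff[OF M.module_axioms] by (auto simp: cyclic_space_def inj_on_def)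
  next
    case False
    \<comment> \<open>As \<open>g (lift y) = y\<close>, this composite is multiplication on
      \<open>y\<close>, injective by freeness. Its inner factor is therefore injective, which gives
      freeness upstairs, and \<open>g\<close> is injective on the image of that factor.\<close>
    then have "inj_on (\<lambda>p. g (sM p (lift y))) (polys_in Z)"
      using free lift_spec[OF that(1)] by (simp add: free_cyclic_space_iff N.module_axioms g.scale)
    then have inj_comp: "inj_on (g \<circ> (\<lambda>p. sM p (lift y))) (polys_in Z)"
      by (simp add: comp_def)
    then show ?thesis
      using inj_on_imageI[OF inj_comp] inj_on_imageI2[OF inj_comp]
      unfolding free_cyclic_space_iff[OF M.module_axioms] by (simp add: cyclic_space_def)
  qed
  define D where "D = map (map_prod f id) DU @ map (map_prod lift id) DN"
  have DU': "(\<exists>d. m \<in> GU d) \<and> free_over sU (polys_in Z) (cyclic_space sU m Z)"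
    if "(m, Z) \<in> set DU" for m Z
    using DU that by (auto simp: stanley_decomposition_def)
  have DN': "(\<exists>d. m \<in> GN d)" "free_over sN (polys_in Z) (cyclic_space sN m Z)"
    if "(m, Z) \<in> set DN" for m Z
    using DN that by (auto simp: stanley_decomposition_def)
  have fU: "(\<exists>d. f m \<in> GM d) \<and> free_over sM (polys_in Z) (cyclic_space sM (f m) Z)"
    if "(m, Z) \<in> set DU" for m Z
  proof
    show "\<exists>d. f m \<in> GM d"
      using DU'[OF that] f unfolding homogeneous_hom_def by blast
    \<comment> \<open>Both alternatives pass to \<open>f m\<close>: \<open>f\<close> maps 0 to 0,
      and multiplication on \<open>f m\<close> is multiplication on \<open>m\<close> followed by the
      injection \<open>f\<close>.\<close>
    have "m = 0 \<or> inj_on (\<lambda>p. sU p m) (polys_in Z)"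
      using DU'[OF that] free_cyclic_space_iff[OF U.module_axioms] by blast
    then show "free_over sM (polys_in Z) (cyclic_space sM (f m) Z)"
      using inj by (auto simp: free_cyclic_space_iff M.module_axioms inj_on_def simp flip: f.scale)
  qed
  have "(\<exists>d. m \<in> GM d) \<and> free_over sM (polys_in Z) (cyclic_space sM m Z)"
    if "(m, Z) \<in> set D" for m Z
  proof -
    from that
    consider m' where "(m', Z) \<in> set DU" "m = f m'" | m' where "(m', Z) \<in> set DN" "m = lift m'"
      by (auto simp: D_def)
    then show ?thesis
    proof cases
      case (1 m')
      then show ?thesis
        using fU by simp
    next
      case (2 m')
      then show ?thesis
        using DN'[OF 2(1)] lift_spec[of m'] lift_inj[of m' Z] by simp
    qed
  qed
  moreover have "direct_sum_decomp {..<length DU + length DN}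
    (\<lambda>i. cyclic_space sM (fst (D ! i)) (snd (D ! i)))"
  proof (rule direct_sum_decomp_extension[OF homogeneous_hom_additive[OF f]
        homogeneous_hom_additive[OF g] inj exact])
    show "direct_sum_decomp {..<length DU} (\<lambda>i. cyclic_space sU (fst (DU ! i)) (snd (DU ! i)))"
      using DU by (simp add: stanley_decomposition_def)
    show "direct_sum_decomp {..<length DN} (\<lambda>i. cyclic_space sN (fst (DN ! i)) (snd (DN ! i)))"
      using DN by (simp add: stanley_decomposition_def)
    show "cyclic_space sM (fst (D ! i)) (snd (D ! i)) =
        f ` cyclic_space sU (fst (DU ! i)) (snd (DU ! i))" if "i < length DU" for i
      using that by (simp add: D_def nth_append homogeneous_hom_cyclic_space[OF f])
    show "bij_betw g (cyclic_space sM (fst (D ! (length DU + j))) (snd (D ! (length DU + j))))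
        (cyclic_space sN (fst (DN ! j)) (snd (DN ! j)))" if j: "j < length DN" for j
    proof -
      obtain m Z where mZ: "DN ! j = (m, Z)"
        by fastforce
      then have "(m, Z) \<in> set DN"
        using j nth_mem by metis
      \<comment> \<open>The first fact identifies the image of the lifted space under
        \<open>g\<close>, the second gives injectivity.\<close>
      then have "g (lift m) = m" "inj_on g (cyclic_space sM (lift m) Z)"
        using DN'[of m Z] lift_spec[of m] lift_inj[of m Z] by simp_all
      then show ?thesis
        using j mZ homogeneous_hom_cyclic_space[OF g, of "lift m" Z]
        by (simp add: D_def nth_append bij_betw_def)
    qed
  qed (simp_all add: zero_in_cyclic_space diff_in_cyclic_space U.module_axioms M.module_axioms
      N.module_axioms)
  moreover have len: "length D = length DU + length DN"
    by (simp add: D_def)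
  ultimately have "stanley_decomposition sM GM D"
    by (auto simp: stanley_decomposition_def)
  then show ?thesis
    using that len by blast
qed

theorem proposition2p1:
  fixes sU :: "('v::finite, 'k::field) mpol \<Rightarrow> 'u::ab_group_add \<Rightarrow> 'u"
    and sM :: "('v, 'k) mpol \<Rightarrow> 'm::ab_group_add \<Rightarrow> 'm"
    and sN :: "('v, 'k) mpol \<Rightarrow> 'n::ab_group_add \<Rightarrow> 'n"
    and GU :: "('v \<Rightarrow> int) \<Rightarrow> 'u set"
    and GM :: "('v \<Rightarrow> int) \<Rightarrow> 'm set"
    and GN :: "('v \<Rightarrow> int) \<Rightarrow> 'n set"
    and f :: "'u \<Rightarrow> 'm" and g :: "'m \<Rightarrow> 'n"
  assumes "fg_multigraded_module sU GU"
    and "fg_multigraded_module sM GM"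
    and "fg_multigraded_module sN GN"
    and "homogeneous_hom sU GU sM GM f"
    and "homogeneous_hom sM GM sN GN g"
    and "inj f" and "range f = {x. g x = 0}" and "surj g"
  shows "slength sM GM \<le> slength sU GU + slength sN GN"
proof (cases "(\<exists>D. stanley_decomposition sU GU D) \<and> (\<exists>D. stanley_decomposition sN GN D)")
  case True
  then obtain DU DN where
    DU: "stanley_decomposition sU GU DU" "slength sU GU = enat (length DU)" and
    DN: "stanley_decomposition sN GN DN" "slength sN GN = enat (length DN)"
    using slength_attained by metis
  obtain D where D: "stanley_decomposition sM GM D" "length D = length DU + length DN"
    using stanley_decomposition_extension[OF assms DU(1) DN(1)] .
  have "slength sM GM \<le> enat (length D)"
    unfolding slength_def using D(1) by (intro INF_lower) simp
  then show ?thesis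
    using D(2) DU(2) DN(2) by simp
next
  case False
  \<comment> \<open>An infimum over the empty set is \<infinity>, so the right-hand side is
    infinite.\<close>
  then have "Collect (stanley_decomposition sU GU) = {} \<or> Collect (stanley_decomposition sN GN) = {}"
    by blast
  then have "slength sU GU = \<infinity> \<or> slength sN GN = \<infinity>"
    unfolding slength_def by (metis image_empty Inf_empty top_enat_def)
  then show ?thesis
    by auto
qed

end
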